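(* Let $G$ be a connected graph on $n$ vertices and $H$ a connected graph on $k\ge 2$ vertices with diameter $D_H$. Then $$\lambda(G,H)\ge \frac{2k}{D_H^2\,\mathrm{vol}(G)\,(k-1)}.$$
   Context: All graphs are finite and simple. For a graph $G$, $d_v$ denotes the degree of $v$, $u\sim v$ means adjacency, and $\mathrm{vol}(G)=\sum_v d_v$. For a metric space $(X,d)$ and $f:V(G)\to X$ set $R_f(G,X)=\frac{\mathrm{vol}(G)\sum_{u\sim v} d(f(u),f(v))^2}{\sum_{u,v} d(f(u),f(v))^2 d_u d_v}$, where the numerator sum is over edges of $G$ and the denominator sum over unordered pairs of vertices; $\lambda(G,X)=\inf_f R_f(G,X)$ over all $f$ with nonzero denominator. A connected graph $H$ is regarded as the metric space $(V(H),d_H)$ with shortest-path distance, $\lambda(G,H)=\lambda(G,(V(H),d_H))$, and $D_H$ is the diameter of $H$. *)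

theory Defs
  imports "Graph_Theory.Graph_Theory" "HOL-Analysis.Abstract_Metric_Spaces"
begin

text \<open>
  A finite simple graph is a digraph satisfying the locale predicate \<^const>\<open>graph\<close> (finite,
  loop-free, without parallel arcs, symmetric): every edge is represented by its two
  opposite arcs, so the degree of a vertex is its \<^const>\<open>out_degree\<close>.
\<close>

definition vol :: "('a, 'b) pre_digraph \<Rightarrow> real" where
  "vol G = (\<Sum>v\<in>verts G. real (out_degree G v))"

text \<open>
  In both sums below each unordered object is met exactly twice: an edge as its two arcs, a pair
  of distinct vertices as its two orderings. Hence the factors 1/2. For a metric \<open>d\<close> the
  diagonal terms of the second sum vanish.
\<close>

definition edge_energy :: "('a, 'b) pre_digraph \<Rightarrow> ('x \<Rightarrow> 'x \<Rightarrow> real) \<Rightarrow> ('a \<Rightarrow> 'x) \<Rightarrow> real" where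
  "edge_energy G d f = (\<Sum>e\<in>arcs G. (d (f (tail G e)) (f (head G e)))\<^sup>2) / 2"

definition pair_energy :: "('a, 'b) pre_digraph \<Rightarrow> ('x \<Rightarrow> 'x \<Rightarrow> real) \<Rightarrow> ('a \<Rightarrow> 'x) \<Rightarrow> real" where
  "pair_energy G d f =
     (\<Sum>u\<in>verts G. \<Sum>v\<in>verts G.
        (d (f u) (f v))\<^sup>2 * real (out_degree G u) * real (out_degree G v)) / 2"

definition rayleigh :: "('a, 'b) pre_digraph \<Rightarrow> ('x \<Rightarrow> 'x \<Rightarrow> real) \<Rightarrow> ('a \<Rightarrow> 'x) \<Rightarrow> real" where
  "rayleigh G d f = vol G * edge_energy G d f / pair_energy G d f"

text \<open>
  The metric space is given by its carrier \<open>X\<close> and distance \<open>d\<close>, as in \<^locale>\<open>Metric_space\<close>.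
  The infimum is taken in the extended reals: it is \<open>\<infinity>\<close> if no \<open>f\<close> is admissible, e.g. if
  \<open>G\<close> has a single vertex.
\<close>

definition lambda_metric ::
    "('a, 'b) pre_digraph \<Rightarrow> 'x set \<Rightarrow> ('x \<Rightarrow> 'x \<Rightarrow> real) \<Rightarrow> ereal" where
  "lambda_metric G X d =
     (INF f \<in> {f \<in> verts G \<rightarrow> X. pair_energy G d f \<noteq> 0}. ereal (rayleigh G d f))"

text \<open>
  The shortest path distance \<^const>\<open>wf_digraph.\<mu>\<close> for unit arc costs. It is \<open>\<infinity>\<close>, which
  \<^const>\<open>real_of_ereal\<close> sends to 0, only between vertices in different components.
\<close>

definition graph_dist :: "('a, 'b) pre_digraph \<Rightarrow> 'a \<Rightarrow> 'a \<Rightarrow> real" where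
  "graph_dist H u v = real_of_ereal (wf_digraph.\<mu> H (\<lambda>_. 1) u v)"

text \<open>A connected graph with its shortest path distance is a metric space.\<close>

lemma (in wf_digraph) awalk_cost_unit: "awalk_cost (\<lambda>_. 1) p = real (length p)"
  by (induct p) auto

lemma graph_dist_le_length:
  assumes "graph H" "pre_digraph.awalk H u p v"
  shows "graph_dist H u v \<le> real (length p)"
proof -
  interpret graph H by fact
  have reach: "u \<rightarrow>\<^sup>*\<^bsub>H\<^esub> v" using assms(2) by (auto simp: reachable_awalk)
  obtain q where "\<mu> (\<lambda>_. 1) u v = ereal (awalk_cost (\<lambda>_. 1) q)"
    using min_cost_awalk[OF reach, of "\<lambda>_. 1"] by auto
  moreover have "\<mu> (\<lambda>_. 1) u v \<le> ereal (awalk_cost (\<lambda>_. 1) p)"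
    by (rule min_cost_le_walk_cost[OF assms(2)])
  ultimately show ?thesis by (simp add: graph_dist_def awalk_cost_unit)
qed

lemma graph_dist_walk:
  assumes "graph H" "Digraph_Component.connected H" "u \<in> verts H" "v \<in> verts H"
  obtains p where "pre_digraph.awalk H u p v" "graph_dist H u v = real (length p)"
proof -
  interpret graph H by fact
  have reach: "u \<rightarrow>\<^sup>*\<^bsub>H\<^esub> v"
    using symmetric_connected_imp_strongly_connected[OF sym_arcs assms(2)] assms(3,4)
    by (auto simp: strongly_connected_def)
  obtain q where "apath u q v" "\<mu> (\<lambda>_. 1) u v = ereal (awalk_cost (\<lambda>_. 1) q)"
    using min_cost_awalk[OF reach, of "\<lambda>_. 1"] by auto
  then show ?thesis using that[of q] by (auto simp: graph_dist_def awalk_cost_unit apath_def)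
qed

lemma graph_awalk_rev:
  assumes "graph H" "pre_digraph.awalk H u p v"
  shows "\<exists>q. pre_digraph.awalk H v q u \<and> length q = length p"
proof -
  interpret graph H by fact
  show ?thesis using assms(2)
  proof (induct p arbitrary: u)
    case Nil
    then show ?case by (auto simp: awalk_Nil_iff)
  next
    case (Cons e es)
    then have e: "e \<in> arcs H" "tail H e = u" "awalk (head H e) es v"
      by (auto simp: awalk_Cons_iff)
    obtain q where q: "awalk v q (head H e)" "length q = length es"
      using Cons(1)[OF e(3)] by blast
    obtain e' where e': "e' \<in> arcs H" "tail H e' = head H e" "head H e' = u"
      using sym_arcs e unfolding symmetric_conv by metis
    have "awalk v (q @ [e']) u"
      using q(1) e' by (auto simp: awalk_Cons_iff awalk_Nil_iff intro!: awalk_appendI)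
    then show ?case using q(2) by (intro exI[of _ "q @ [e']"]) simp
  qed
qed

lemma graph_dist_Metric_space:
  assumes "graph H" "Digraph_Component.connected H"
  shows "Metric_space (verts H) (graph_dist H)"
proof -
  interpret graph H by fact
  have le: "graph_dist H u v \<le> graph_dist H v u" if "u \<in> verts H" "v \<in> verts H" for u v
    using graph_dist_walk[OF assms that(2,1)] graph_awalk_rev[OF assms(1)]
      graph_dist_le_length[OF assms(1)] by metis
  have nn: "0 \<le> graph_dist H u v" for u v
  proof -
    have "0 \<le> \<mu> (\<lambda>_. 1) u v"
      unfolding \<mu>_def by (rule INF_greatest) (simp add: awalk_cost_unit)
    then show ?thesis by (simp add: graph_dist_def real_of_ereal_pos)
  qed
  show ?thesis
  proof
    fix u v show "0 \<le> graph_dist H u v" by (rule nn)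
    show "graph_dist H u v = graph_dist H v u"
    proof (cases "u \<in> verts H \<and> v \<in> verts H")
      case True
      then show ?thesis using le by (simp add: antisym)
    next
      case False
      then have "\<not> u \<rightarrow>\<^sup>*\<^bsub>H\<^esub> v" "\<not> v \<rightarrow>\<^sup>*\<^bsub>H\<^esub> u" by (auto dest: reachable_in_verts)
      then show ?thesis by (simp add: graph_dist_def shortest_path_inf)
    qed
  next
    fix u v assume uv: "u \<in> verts H" "v \<in> verts H"
    obtain p where p: "awalk u p v" "graph_dist H u v = real (length p)"
      using graph_dist_walk[OF assms uv] by blast
    have "awalk u [] u" using uv by (simp add: awalk_Nil_iff)
    from graph_dist_le_length[OF assms(1) this] have "graph_dist H u u = 0"
      using nn[of u u] by simp
    then show "graph_dist H u v = 0 \<longleftrightarrow> u = v"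
      using p by (auto simp: awalk_Nil_iff)
  next
    fix u v w assume uvw: "u \<in> verts H" "v \<in> verts H" "w \<in> verts H"
    obtain p where p: "awalk u p v" "graph_dist H u v = real (length p)"
      using graph_dist_walk[OF assms uvw(1,2)] by blast
    obtain q where q: "awalk v q w" "graph_dist H v w = real (length q)"
      using graph_dist_walk[OF assms uvw(2,3)] by blast
    show "graph_dist H u w \<le> graph_dist H u v + graph_dist H v w"
      using graph_dist_le_length[OF assms(1) awalk_appendI[OF p(1) q(1)]] p(2) q(2) by simp
  qed
qed

definition graph_diam :: "('a, 'b) pre_digraph \<Rightarrow> real" where
  "graph_diam H = Max ((\<lambda>(u, v). graph_dist H u v) ` (verts H \<times> verts H))"

definition lambda_graph :: "('a, 'b) pre_digraph \<Rightarrow> ('c, 'd) pre_digraph \<Rightarrow> ereal" where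
  "lambda_graph G H = lambda_metric G (verts H) (graph_dist H)"

end

theory Submission
  imports Defs
begin

text \<open>
  A map \<open>f\<close> with nonzero pair energy is not constant, so by connectedness of \<open>G\<close> some edge has
  endpoints with different images, at distance at least 1; hence the edge energy is at least 1.
  For the denominator bound every nonzero distance by the diameter. What remains is the degree
  mass of the pairs in different fibres of \<open>f\<close>: with \<open>V\<^sub>x\<close> the volume of the fibre over \<open>x\<close> this
  is \<open>(vol G\<^sup>2 - (\<Sum>x. V\<^sub>x\<^sup>2)) / 2\<close>, at most \<open>vol G\<^sup>2 (1 - 1/k) / 2\<close> by Cauchy-Schwarz.
\<close>

text \<open>Grouping by the value of \<open>f\<close> turns the double sum into the sum of the
  squared fibre weights, one for each point of \<open>X\<close>. These weights add up to
  \<open>sum w A\<close>, so Cauchy-Schwarz against the constant 1 gives the factor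
  \<open>card X\<close>; empty fibres contribute 0.\<close>

lemma square_sum_le_card_mult_fibres:
  fixes w :: "'a \<Rightarrow> real"
  assumes "finite A" "finite X" "f \<in> A \<rightarrow> X"
  shows "(sum w A)\<^sup>2 \<le> real (card X) * (\<Sum>u\<in>A. \<Sum>v\<in>A. if f u = f v then w u * w v else 0)"
proof -
  let ?V = "\<lambda>x. \<Sum>u | u \<in> A \<and> f u = x. w u"
  have "(\<Sum>u\<in>A. \<Sum>v\<in>A. if f u = f v then w u * w v else 0) = (\<Sum>u\<in>A. w u * ?V (f u))"
    using assms(1) by (intro sum.cong refl)
      (auto simp: sum_distrib_left sum.inter_filter intro!: sum.cong)
  also have "\<dots> = (\<Sum>x\<in>X. \<Sum>u | u \<in> A \<and> f u = x. w u * ?V (f u))"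
    using assms by (intro sum.group[symmetric]) auto
  also have "\<dots> = (\<Sum>x\<in>X. (?V x)\<^sup>2)"
    by (intro sum.cong refl) (auto simp: power2_eq_square sum_distrib_right)
  finally have "(\<Sum>u\<in>A. \<Sum>v\<in>A. if f u = f v then w u * w v else 0) = (\<Sum>x\<in>X. (?V x)\<^sup>2)" .
  moreover have "sum w A = (\<Sum>x\<in>X. ?V x)"
    using assms by (intro sum.group[symmetric]) auto
  ultimately show ?thesis
    using sum_squared_le_sum_of_squares[of ?V X] by (simp add: mult.commute)
qed

lemma graph_dist_ge_1:
  assumes "graph H" "Digraph_Component.connected H" "u \<in> verts H" "v \<in> verts H" "u \<noteq> v"
  shows "1 \<le> graph_dist H u v"
proof -
  interpret graph H by fact
  obtain p where p: "awalk u p v" "graph_dist H u v = real (length p)"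
    using graph_dist_walk[OF assms(1-4)] .
  have "p \<noteq> []" using p(1) assms(5) by (auto simp: awalk_Nil_iff)
  then show ?thesis using p(2) by (cases p) auto
qed

lemma graph_dist_le_diam:
  assumes "graph H" "u \<in> verts H" "v \<in> verts H"
  shows "graph_dist H u v \<le> graph_diam H"
proof -
  interpret graph H by fact
  show ?thesis unfolding graph_diam_def using assms(2,3) by (intro Max_ge) auto
qed

text \<open>Along a walk from \<open>u\<close> to \<open>v\<close> the value of \<open>f\<close> has
  to change at some arc. The induction follows the walk for as long as \<open>f\<close> keeps its
  initial value.\<close>

lemma nonconstant_imp_edge:
  assumes "graph G" "Digraph_Component.connected G" "u \<in> verts G" "v \<in> verts G" "f u \<noteq> f v"
  obtains e where "e \<in> arcs G" "f (tail G e) \<noteq> f (head G e)"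
proof -
  interpret graph G by fact
  obtain p where "awalk u p v" using graph_dist_walk[OF assms(1-4)] .
  then have "\<exists>e\<in>arcs G. f (tail G e) \<noteq> f (head G e)" using assms(5)
  proof (induct p arbitrary: u)
    case Nil
    then show ?case by (auto simp: awalk_Nil_iff)
  next
    case (Cons e p)
    then have e: "e \<in> arcs G" "tail G e = u" "awalk (head G e) p v"
      by (auto simp: awalk_Cons_iff)
    show ?case
    proof (cases "f (head G e) = f u")
      case True
      then show ?thesis using Cons(1)[OF e(3)] Cons(3) by simp
    next
      case False
      then show ?thesis using e by metis
    qed
  qed
  then show ?thesis using that by blast
qed

text \<open>One stretched edge suffices: it occurs as two opposite arcs, each contributing at least
  1, which offsets the division by 2.\<close>

lemma edge_energy_ge_1:
  assumes "graph G" and e: "e \<in> arcs G"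
    and sym: "\<And>x y. d x y = d y x" and ge: "1 \<le> d (f (tail G e)) (f (head G e))"
  shows "1 \<le> edge_energy G d f"
proof -
  interpret graph G by fact
  let ?g = "\<lambda>e. (d (f (tail G e)) (f (head G e)))\<^sup>2"
  obtain e' where e': "e' \<in> arcs G" "tail G e' = head G e" "head G e' = tail G e"
    using sym_arcs e unfolding symmetric_conv by metis
  \<comment> \<open>Equality would make \<open>e\<close> a loop.\<close>
  have ne: "e \<noteq> e'" using e' no_loops e by metis
  have g: "1 \<le> ?g e" using ge by (simp add: one_le_power)
  have "?g e' = ?g e" using e' sym by simp
  with g ne have "2 \<le> sum ?g {e, e'}" by simp
  also have "\<dots> \<le> sum ?g (arcs G)" using e e' by (intro sum_mono2) auto
  finally show ?thesis by (simp add: edge_energy_def)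
qed

lemma pair_energy_le:
  assumes "finite (verts G)" "finite X" "X \<noteq> {}" "f \<in> verts G \<rightarrow> X"
    and d: "\<And>x. x \<in> X \<Longrightarrow> d x x = 0" "\<And>x y. x \<in> X \<Longrightarrow> y \<in> X \<Longrightarrow> \<bar>d x y\<bar> \<le> D"
  shows "pair_energy G d f \<le> D\<^sup>2 * (vol G)\<^sup>2 * (real (card X) - 1) / (2 * real (card X))"
proof -
  let ?w = "\<lambda>v. real (out_degree G v)"
  let ?S = "\<Sum>u\<in>verts G. \<Sum>v\<in>verts G. if f u = f v then ?w u * ?w v else 0"
  have k: "real (card X) > 0" using assms(2,3) by (simp add: card_gt_0_iff)
  have fib: "(vol G)\<^sup>2 \<le> real (card X) * ?S"
    unfolding vol_def using assms(1,2,4) by (rule square_sum_le_card_mult_fibres)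
  \<comment> \<open>Pairs inside a fibre have distance 0, so their degree mass can be removed from
    the bound; all other pairs are bounded by \<open>D\<^sup>2\<close>.\<close>
  have "2 * pair_energy G d f
      \<le> (\<Sum>u\<in>verts G. \<Sum>v\<in>verts G. D\<^sup>2 * (?w u * ?w v - (if f u = f v then ?w u * ?w v else 0)))"
    unfolding pair_energy_def mult_2 field_sum_of_halves
  proof (intro sum_mono)
    fix u v assume "u \<in> verts G" "v \<in> verts G"
    then have uv: "f u \<in> X" "f v \<in> X" using assms(4) by auto
    have "(d (f u) (f v))\<^sup>2 \<le> D\<^sup>2" using d(2)[OF uv] by (simp add: abs_le_square_iff[symmetric])
    then have "(d (f u) (f v))\<^sup>2 * (?w u * ?w v) \<le> D\<^sup>2 * (?w u * ?w v)"
      by (intro mult_right_mono) auto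
    then show "(d (f u) (f v))\<^sup>2 * ?w u * ?w v
        \<le> D\<^sup>2 * (?w u * ?w v - (if f u = f v then ?w u * ?w v else 0))"
      using d(1)[OF uv(2)] by (auto simp: mult.assoc)
  qed
  also have "\<dots> = D\<^sup>2 * ((vol G)\<^sup>2 - ?S)"
    by (simp add: vol_def power2_eq_square sum_product sum_subtractf flip: sum_distrib_left)
  also have "\<dots> \<le> D\<^sup>2 * ((vol G)\<^sup>2 - (vol G)\<^sup>2 / real (card X))"
    using fib k by (intro mult_left_mono) (auto simp: field_simps)
  also have "\<dots> = D\<^sup>2 * (vol G)\<^sup>2 * (real (card X) - 1) / real (card X)"
    using k by (simp add: field_simps)
  finally show ?thesis using k by (simp add: field_simps)
qed

theorem theorem4p5:
  fixes G :: "('a, 'b) pre_digraph" and H :: "('c, 'd) pre_digraph" and n k :: nat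
  assumes "graph G" and "Digraph_Component.connected G" and "card (verts G) = n"
    and "graph H" and "Digraph_Component.connected H" and "card (verts H) = k" and "k \<ge> 2"
  shows "lambda_graph G H
           \<ge> ereal (2 * real k) / ereal ((graph_diam H)\<^sup>2 * vol G * (real k - 1))"
  unfolding lambda_graph_def lambda_metric_def
proof (rule INF_greatest)
  interpret G: graph G by fact
  interpret H: graph H by fact
  interpret M: Metric_space "verts H" "graph_dist H"
    by (rule graph_dist_Metric_space) fact+
  let ?D = "graph_diam H" and ?P = "pair_energy G (graph_dist H)"
    and ?E = "edge_energy G (graph_dist H)"
  fix f assume "f \<in> {f \<in> verts G \<rightarrow> verts H. ?P f \<noteq> 0}"
  then have f: "f \<in> verts G \<rightarrow> verts H" "?P f \<noteq> 0" by auto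
  have "\<exists>u\<in>verts G. \<exists>v\<in>verts G. f u \<noteq> f v"
  proof (rule ccontr)
    assume "\<not> ?thesis"
    then have "graph_dist H (f u) (f v) = 0" if "u \<in> verts G" "v \<in> verts G" for u v
      using that f(1) by (metis M.mdist_zero PiE)
    then show False using f(2) by (simp add: pair_energy_def)
  qed
  then obtain e where e: "e \<in> arcs G" "f (tail G e) \<noteq> f (head G e)"
    using nonconstant_imp_edge[OF assms(1,2)] by metis
  have "1 \<le> graph_dist H (f (tail G e)) (f (head G e))"
    using e f(1) by (intro graph_dist_ge_1 assms) auto
  then have E: "1 \<le> ?E f"
    by (intro edge_energy_ge_1[OF assms(1) e(1)] M.commute)
  have "verts H \<noteq> {}" using assms(6,7) by auto
  then have P: "?P f \<le> ?D\<^sup>2 * (vol G)\<^sup>2 * (real k - 1) / (2 * real k)"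
    using pair_energy_le[OF _ _ _ f(1), of "graph_dist H" ?D] graph_dist_le_diam[OF assms(4)]
      assms(6) by simp
  \<comment> \<open>Admissibility only says that the pair energy is nonzero; dividing inequalities
    by it requires a positive value.\<close>
  have "0 \<le> ?P f" by (simp add: pair_energy_def sum_nonneg)
  with f(2) have P0: "0 < ?P f" by simp
  have k: "real k \<ge> 2" using assms(7) by simp
  have "vol G \<ge> 0" by (simp add: vol_def sum_nonneg)
  \<comment> \<open>If either were 0, the upper bound \<open>P\<close> would be 0, contradicting
    \<open>P0\<close>.\<close>
  moreover have D0: "?D \<noteq> 0" and "vol G \<noteq> 0" using P P0 by auto
  ultimately have vol: "vol G > 0" by simp
  \<comment> \<open>The claimed bound is the Rayleigh quotient with \<open>?E f\<close> replaced by
    its lower bound 1 and \<open>?P f\<close> by its upper bound \<open>P\<close>.\<close>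
  have "2 * real k / (?D\<^sup>2 * vol G * (real k - 1))
      = vol G * 1 / (?D\<^sup>2 * (vol G)\<^sup>2 * (real k - 1) / (2 * real k))"
    using vol k D0 by (simp add: power2_eq_square)
  also have "\<dots> \<le> vol G * ?E f / ?P f"
    using P P0 E vol by (intro frac_le mult_left_mono) auto
  \<comment> \<open>The denominator is nonzero, so the quotient in \<open>ereal\<close> is the real
    one.\<close>
  finally show "ereal (2 * real k) / ereal (?D\<^sup>2 * vol G * (real k - 1))
      \<le> ereal (rayleigh G (graph_dist H) f)"
    using D0 vol assms(7) by (simp add: rayleigh_def)
qed

end
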